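(* Let $T$ be a nonnegative $n\times n$ matrix such that $T = MN - NM$ for some nonnegative $n\times n$ matrices $M$ and $N$ with $M^2 = N^2 = 0$. Then $MT = TM = NT = TN = 0$, and there exists a decomposition $\mathbb{R}^n = L_1\oplus L_2\oplus L_3$ into standard subspaces with respect to which the operator $T$ is of the form $$T=\begin{pmatrix} 0 & 0 & T_{13}\\ 0 & 0 & 0\\ 0 & 0 & 0\end{pmatrix}$$ for some positive operator $T_{13}\colon L_3\to L_1$ with $\operatorname{rank}(T_{13})\le \dim(L_2)$.
   Context: A matrix is nonnegative if all its entries are (real and) nonnegative. A standard subspace of $\mathbb{R}^n$ is the linear span of some (possibly empty) set of standard unit vectors; in a decomposition $\mathbb{R}^n=L_1\oplus L_2\oplus L_3$ into standard subspaces, the $L_i$ are thus spanned by disjoint sets of standard unit vectors that together give all of them, and some $L_i$ may be $\{0\}$. A linear operator between such subspaces is positive if it maps vectors with nonnegative coordinates to vectors with nonnegative coordinates. Here $\operatorname{rank}$ is the usual rank. *)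

theory Defs
  imports "HOL-Analysis.Analysis"
begin

definition nonneg_matrix :: "real ^ 'n ^ 'm \<Rightarrow> bool" where
  "nonneg_matrix A \<longleftrightarrow> (\<forall>i j. 0 \<le> A $ i $ j)"

definition nonneg_vector :: "real ^ 'n \<Rightarrow> bool" where
  "nonneg_vector x \<longleftrightarrow> (\<forall>i. 0 \<le> x $ i)"

definition standard_subspace :: "(real ^ 'n) set \<Rightarrow> bool" where
  "standard_subspace L \<longleftrightarrow> (\<exists>I :: 'n set. L = span ((\<lambda>i. axis i 1) ` I))"

definition direct_sum3 :: "'a::real_vector set \<Rightarrow> 'a set \<Rightarrow> 'a set \<Rightarrow> bool" where
  "direct_sum3 L1 L2 L3 \<longleftrightarrow>
     subspace L1 \<and> subspace L2 \<and> subspace L3 \<and>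
     (\<forall>x. \<exists>!(x1, x2, x3). x1 \<in> L1 \<and> x2 \<in> L2 \<and> x3 \<in> L3 \<and> x = x1 + x2 + x3)"

text \<open>
  Operators between subspaces \<open>V\<close> and \<open>W\<close> are represented by functions on the ambient space;
  only their values on \<open>V\<close> matter.
\<close>

definition linear_operator :: "'a::real_vector set \<Rightarrow> 'b::real_vector set \<Rightarrow> ('a \<Rightarrow> 'b) \<Rightarrow> bool" where
  "linear_operator V W f \<longleftrightarrow>
     f \<in> V \<rightarrow> W \<and>
     (\<forall>x\<in>V. \<forall>y\<in>V. f (x + y) = f x + f y) \<and>
     (\<forall>c. \<forall>x\<in>V. f (c *\<^sub>R x) = c *\<^sub>R f x)"

definition positive_operator ::
  "(real ^ 'n) set \<Rightarrow> (real ^ 'm) set \<Rightarrow> (real ^ 'n \<Rightarrow> real ^ 'm) \<Rightarrow> bool" where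
  "positive_operator V W f \<longleftrightarrow>
     linear_operator V W f \<and> (\<forall>x\<in>V. nonneg_vector x \<longrightarrow> nonneg_vector (f x))"

definition operator_rank :: "'a::real_vector set \<Rightarrow> ('a \<Rightarrow> 'b::real_vector) \<Rightarrow> nat" where
  "operator_rank V f = dim (f ` V)"

text \<open>
  The operator \<open>A\<close> has, with respect to \<open>L1 \<oplus> L2 \<oplus> L3\<close>, the block form whose only possibly
  nonzero block is \<open>f : L3 \<rightarrow> L1\<close> in position \<open>(1,3)\<close>.
\<close>

definition block13_form ::
  "(real ^ 'n) set \<Rightarrow> (real ^ 'n) set \<Rightarrow> (real ^ 'n) set \<Rightarrow>
   real ^ 'n ^ 'n \<Rightarrow> (real ^ 'n \<Rightarrow> real ^ 'n) \<Rightarrow> bool" where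
  "block13_form L1 L2 L3 A f \<longleftrightarrow>
     f \<in> L3 \<rightarrow> L1 \<and>
     (\<forall>x1\<in>L1. \<forall>x2\<in>L2. \<forall>x3\<in>L3. A *v (x1 + x2 + x3) = f x3)"

end

theory Submission
  imports Defs
begin

text \<open>
  Since \<open>M T = - M N M\<close> is both nonnegative and nonpositive it vanishes, and so do
  \<open>T M\<close>, \<open>N T\<close>, \<open>T N\<close> by symmetry; hence also \<open>T\<^sup>2 = 0\<close>. By nonnegativity no index \<open>i\<close> has both
  a nonzero row and a nonzero column in \<open>T\<close>, so the indices split into the set \<open>R\<close> of nonzero rows,
  the set \<open>C\<close> of nonzero columns, and the rest \<open>Z\<close>. Now write
  \<open>T x = (\<Sum>k. (N x)\<^sub>k M\<^sub>k - (M x)\<^sub>k N\<^sub>k)\<close> with \<open>M\<^sub>k\<close>, \<open>N\<^sub>k\<close> the columns. The terms with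
  \<open>k \<in> R\<close> vanish because \<open>M T = N T = 0\<close> kills the columns, those with \<open>k \<in> C\<close> because
  \<open>T M = T N = 0\<close> kills the rows. Finally \<open>M\<^sup>2 = 0\<close> forces \<open>M\<^sub>k = 0\<close> or \<open>(M x)\<^sub>k = 0\<close> for each \<open>k\<close>,
  so every \<open>k \<in> Z\<close> contributes at most one dimension to the range of \<open>T\<close>.
\<close>

lemma nonneg_matrix_mult:
  assumes "nonneg_matrix A" "nonneg_matrix B"
  shows "nonneg_matrix (A ** B)"
  using assms by (auto simp: nonneg_matrix_def matrix_matrix_mult_def intro!: sum_nonneg)

lemma nonneg_matrix_mult_vector:
  assumes "nonneg_matrix A" "nonneg_vector x"
  shows "nonneg_vector (A *v x)"
  using assms
  by (auto simp: nonneg_matrix_def nonneg_vector_def matrix_vector_mult_def intro!: sum_nonneg)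

lemma nonneg_matrix_antisym:
  assumes "nonneg_matrix A" "nonneg_matrix B" "A = - B"
  shows "A = 0"
proof -
  have "A $ i $ j = 0" for i j
  proof -
    have "0 \<le> A $ i $ j" "0 \<le> B $ i $ j"
      using assms(1,2) by (auto simp: nonneg_matrix_def)
    then show ?thesis
      using assms(3) by simp
  qed
  then show ?thesis
    by (simp add: vec_eq_iff)
qed

text \<open>Each entry of \<open>A ** B\<close> is a sum of nonnegative products, so where it
  vanishes every single product does.\<close>

lemma nonneg_matrix_mult_eq_0:
  assumes "nonneg_matrix A" "nonneg_matrix B" "A ** B = 0"
  shows "A $ i $ k = 0 \<or> B $ k $ j = 0"
proof -
  have "(\<Sum>k\<in>UNIV. A $ i $ k * B $ k $ j) = (A ** B) $ i $ j"
    by (simp add: matrix_matrix_mult_def)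
  then have "(\<Sum>k\<in>UNIV. A $ i $ k * B $ k $ j) = 0"
    using assms(3) by simp
  then have "A $ i $ k * B $ k $ j = 0"
    using assms(1,2)
    by (subst (asm) sum_nonneg_eq_0_iff) (auto simp: nonneg_matrix_def)
  then show ?thesis
    by simp
qed

lemma matrix_diff_ldistrib:
  fixes A :: "'a::ring_1 ^ 'n ^ 'm"
  shows "A ** (B - C) = A ** B - A ** C"
  by (simp add: matrix_matrix_mult_def vec_eq_iff sum_subtractf right_diff_distrib)

lemma matrix_diff_rdistrib:
  fixes A B :: "'a::ring_1 ^ 'n ^ 'm"
  shows "(A - B) ** C = A ** C - B ** C"
  by (simp add: matrix_matrix_mult_def vec_eq_iff sum_subtractf left_diff_distrib)

lemma span_axis_eq:
  "span ((\<lambda>i. axis i 1) ` I) = {x :: real ^ 'n. \<forall>i. i \<notin> I \<longrightarrow> x $ i = 0}"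
proof -
  have "(\<lambda>i. axis i 1 :: real ^ 'n) ` I \<subseteq> Basis"
    by (auto simp: Basis_vec_def)
  from span_substd_basis[OF this] show ?thesis
    by (auto simp: Basis_vec_def inner_axis axis_eq_axis image_iff)
qed

lemma dim_image_axis: "dim ((\<lambda>i. axis i 1 :: real ^ 'n) ` I) = card I"
proof -
  have "(\<lambda>i. axis i 1 :: real ^ 'n) ` I \<subseteq> Basis"
    by (auto simp: Basis_vec_def)
  then have "independent ((\<lambda>i. axis i 1 :: real ^ 'n) ` I)"
    using independent_Basis independent_mono by blast
  then have "dim ((\<lambda>i. axis i 1 :: real ^ 'n) ` I) = card ((\<lambda>i. axis i 1 :: real ^ 'n) ` I)"
    by (rule dim_eq_card_independent)
  also have "\<dots> = card I"
    by (rule card_image) (auto simp: inj_on_def axis_eq_axis)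
  finally show ?thesis .
qed

lemma direct_sum3_span_axis:
  fixes I J K :: "'n::finite set"
  assumes "I \<inter> J = {}" "I \<inter> K = {}" "J \<inter> K = {}" "I \<union> J \<union> K = UNIV"
  defines "E \<equiv> \<lambda>S. span ((\<lambda>i. axis i 1 :: real ^ 'n) ` S)"
  shows "direct_sum3 (E I) (E J) (E K)"
proof -
  define p where "p = (\<lambda>S (x :: real ^ 'n). \<chi> i. if i \<in> S then x $ i else 0)"
  have E: "x \<in> E S \<longleftrightarrow> (\<forall>i. i \<notin> S \<longrightarrow> x $ i = 0)" for x S
    by (simp add: E_def span_axis_eq)
  have p_in: "p S x \<in> E S" for S x
    by (simp add: E p_def)
  have p_sum: "x = p I x + p J x + p K x" for x
    using assms(1-4) by (auto simp: vec_eq_iff p_def)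
  have "a = p I x \<and> b = p J x \<and> c = p K x"
    if "a \<in> E I" "b \<in> E J" "c \<in> E K" "x = a + b + c" for x a b c
  proof -
    have "a $ i = p I x $ i \<and> b $ i = p J x $ i \<and> c $ i = p K x $ i" for i
    proof -
      have "i \<notin> I \<Longrightarrow> a $ i = 0" "i \<notin> J \<Longrightarrow> b $ i = 0" "i \<notin> K \<Longrightarrow> c $ i = 0"
        using that by (auto simp: E)
      \<comment> \<open>The sets partition the indices, so at \<open>i\<close> only one summand can
        be nonzero, and it carries all of \<open>x $ i\<close>.\<close>
      moreover have "i \<in> I \<and> i \<notin> J \<and> i \<notin> K \<or> i \<notin> I \<and> i \<in> J \<and> i \<notin> K \<or> i \<notin> I \<and> i \<notin> J \<and> i \<in> K"
        using assms(1-4) by blast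
      ultimately show ?thesis
        using that(4) by (elim disjE conjE) (simp_all add: p_def)
    qed
    then show ?thesis
      by (simp add: vec_eq_iff)
  qed
  then have "\<exists>!(a, b, c). a \<in> E I \<and> b \<in> E J \<and> c \<in> E K \<and> x = a + b + c" for x
    using p_in p_sum by (intro ex1I[of _ "(p I x, p J x, p K x)"]) auto
  then show ?thesis
    by (simp add: direct_sum3_def E_def)
qed

text \<open>\<open>M ** T\<close> and \<open>T ** M\<close> are both \<open>M ** N ** M\<close> up
  to sign, so the sign argument for \<open>M ** T\<close> settles both. For \<open>N\<close> the
  minus sign falls on \<open>T ** N\<close>, which therefore comes first.\<close>

lemma commutator_mult_eq_0:
  fixes T M N :: "real ^ 'n ^ 'n"
  assumes "nonneg_matrix T" "nonneg_matrix M" "nonneg_matrix N"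
    and "T = M ** N - N ** M" and "M ** M = 0" and "N ** N = 0"
  shows "M ** T = 0" "T ** M = 0" "N ** T = 0" "T ** N = 0"
proof -
  have MNM: "nonneg_matrix (M ** N ** M)" and NMN: "nonneg_matrix (N ** M ** N)"
    using assms(2,3) by (simp_all add: nonneg_matrix_mult)
  have MT: "M ** T = - (M ** N ** M)"
    by (simp add: assms(4,5) matrix_diff_ldistrib matrix_mul_assoc)
  then show "M ** T = 0"
    using nonneg_matrix_antisym[OF nonneg_matrix_mult[OF assms(2,1)] MNM] by simp
  with MT have "M ** N ** M = 0"
    by simp
  then show "T ** M = 0"
    by (simp add: assms(4,5) matrix_diff_rdistrib flip: matrix_mul_assoc)
  have TN: "T ** N = - (N ** M ** N)"
    by (simp add: assms(4,6) matrix_diff_rdistrib flip: matrix_mul_assoc)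
  then show "T ** N = 0"
    using nonneg_matrix_antisym[OF nonneg_matrix_mult[OF assms(1,3)] NMN] by simp
  with TN have "N ** M ** N = 0"
    by simp
  then show "N ** T = 0"
    by (simp add: assms(4,6) matrix_diff_ldistrib matrix_mul_assoc)
qed

lemma dim_range_commutator_le:
  fixes M N :: "real ^ 'n ^ 'n"
  assumes "nonneg_matrix M" "M ** M = 0"
    and vanish: "\<And>k. k \<notin> Z \<Longrightarrow> (column k M = 0 \<and> column k N = 0) \<or> (row k M = 0 \<and> row k N = 0)"
  shows "dim (range ((*v) (M ** N - N ** M))) \<le> card Z"
proof -
  define w where "w = (\<lambda>k. if column k M \<noteq> 0 then column k M else column k N)"
  have "(M ** N - N ** M) *v x \<in> span (w ` Z)" for x
  proof -
    have term_in: "(N *v x) $ k *\<^sub>R column k M - (M *v x) $ k *\<^sub>R column k N \<in> span (w ` Z)" for k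
    proof (cases "k \<in> Z")
      case True
      then have w: "w k \<in> span (w ` Z)"
        by (simp add: span_base)
      show ?thesis
      proof (cases "column k M = 0")
        case True
        then show ?thesis
          using span_scale[OF w, of "- ((M *v x) $ k)"] by (simp add: w_def)
      next
        case False
        then obtain i where "M $ i $ k \<noteq> 0"
          by (auto simp: column_def vec_eq_iff)
        then have "M $ k $ j = 0" for j
          using nonneg_matrix_mult_eq_0[OF assms(1,1,2)] by blast
        then have "(M *v x) $ k = 0"
          by (simp add: matrix_vector_mult_def)
        then show ?thesis
          using False span_scale[OF w, of "(N *v x) $ k"] by (simp add: w_def)
      qed
    next
      case False
      have "row k A = 0 \<Longrightarrow> (A *v x) $ k = 0" for A :: "real ^ 'n ^ 'n"
        by (simp add: row_def matrix_vector_mult_def vec_eq_iff)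
      then have "(N *v x) $ k *\<^sub>R column k M - (M *v x) $ k *\<^sub>R column k N = 0"
        using vanish[OF False] by auto
      then show ?thesis
        by (simp only: span_zero)
    qed
    have "(M ** N - N ** M) *v x = M *v (N *v x) - N *v (M *v x)"
      by (simp add: matrix_vector_mult_diff_rdistrib matrix_vector_mul_assoc)
    also have "\<dots> = (\<Sum>k\<in>UNIV. (N *v x) $ k *\<^sub>R column k M - (M *v x) $ k *\<^sub>R column k N)"
      by (simp add: matrix_mult_sum scalar_mult_eq_scaleR sum_subtractf)
    also have "\<dots> \<in> span (w ` Z)"
      by (intro span_sum term_in)
    finally show ?thesis .
  qed
  then have "range ((*v) (M ** N - N ** M)) \<subseteq> span (w ` Z)"
    by blast
  then have "dim (range ((*v) (M ** N - N ** M))) \<le> card (w ` Z)"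
    by (intro dim_le_card) auto
  also have "\<dots> \<le> card Z"
    by (simp add: card_image_le)
  finally show ?thesis .
qed

theorem theorem2p2:
  fixes T M N :: "real ^ 'n ^ 'n"
  assumes "nonneg_matrix T" and "nonneg_matrix M" and "nonneg_matrix N"
    and "T = M ** N - N ** M"
    and "M ** M = 0" and "N ** N = 0"
  shows "M ** T = 0 \<and> T ** M = 0 \<and> N ** T = 0 \<and> T ** N = 0 \<and>
    (\<exists>L1 L2 L3 :: (real ^ 'n) set.
       standard_subspace L1 \<and> standard_subspace L2 \<and> standard_subspace L3 \<and>
       direct_sum3 L1 L2 L3 \<and>
       (\<exists>T13 :: real ^ 'n \<Rightarrow> real ^ 'n.
          positive_operator L3 L1 T13 \<and>
          block13_form L1 L2 L3 T T13 \<and>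
          operator_rank L3 T13 \<le> dim L2))"
proof -
  note annihilate = commutator_mult_eq_0[OF assms]
  \<comment> \<open>Expanding the left factor gives
    \<open>M ** (N ** T) - N ** (M ** T)\<close>.\<close>
  have TT: "T ** T = 0"
    using annihilate(1,3) by (subst (1) assms(4))
      (simp add: matrix_diff_rdistrib flip: matrix_mul_assoc)
  define R where "R = {i. \<exists>j. T $ i $ j \<noteq> 0}"
  define C where "C = {j. \<exists>i. T $ i $ j \<noteq> 0}"
  define Z where "Z = - (R \<union> C)"
  define E where "E = (\<lambda>S. span ((\<lambda>i. axis i 1 :: real ^ 'n) ` S))"
  have E: "x \<in> E S \<longleftrightarrow> (\<forall>i. i \<notin> S \<longrightarrow> x $ i = 0)" for x S
    by (simp add: E_def span_axis_eq)
  \<comment> \<open>A common index \<open>k\<close> would give nonzero entries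
    \<open>T $ i $ k\<close> and \<open>T $ k $ j\<close>, against
    \<open>T ** T = 0\<close>.\<close>
  have "R \<inter> C = {}"
    using nonneg_matrix_mult_eq_0[OF assms(1,1) TT] by (fastforce simp: R_def C_def)
  \<comment> \<open>The order matters: the range of \<open>T\<close> lies in \<open>E R\<close>, so
    this is \<open>L1\<close>, and \<open>T\<close> sees only coordinates in \<open>C\<close>, so
    \<open>E C\<close> is \<open>L3\<close>.\<close>
  have dsum: "direct_sum3 (E R) (E Z) (E C)"
    unfolding E_def
    by (rule direct_sum3_span_axis) (use \<open>R \<inter> C = {}\<close> in \<open>auto simp: Z_def\<close>)
  have std: "standard_subspace (E S)" for S
    by (auto simp: standard_subspace_def E_def)
  have T_in: "T *v x \<in> E R" for x
    by (auto simp: E R_def matrix_vector_mult_def)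
  have T_zero: "T *v x = 0" if "x \<in> E S" "S \<inter> C = {}" for x S
  proof -
    \<comment> \<open>For \<open>j\<close> in \<open>C\<close>, disjointness gives
      \<open>x $ j = 0\<close>; otherwise column \<open>j\<close> of \<open>T\<close> is
      zero.\<close>
    have "T $ i $ j * x $ j = 0" for i j
      using that by (cases "j \<in> C") (auto simp: E C_def)
    then show ?thesis
      by (auto simp: matrix_vector_mult_def vec_eq_iff intro!: sum.neutral)
  qed
  have "positive_operator (E C) (E R) ((*v) T)"
    using T_in nonneg_matrix_mult_vector[OF assms(1)]
    by (simp add: positive_operator_def linear_operator_def
        matrix_vector_right_distrib matrix_vector_mult_scaleR)
  moreover have "block13_form (E R) (E Z) (E C) T ((*v) T)"
    using T_in T_zero[of _ R] T_zero[of _ Z] \<open>R \<inter> C = {}\<close>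
    by (auto simp: block13_form_def Z_def matrix_vector_right_distrib)
  moreover have "operator_rank (E C) ((*v) T) \<le> dim (E Z)"
  proof -
    have "(column k M = 0 \<and> column k N = 0) \<or> (row k M = 0 \<and> row k N = 0)" if "k \<notin> Z" for k
    proof (cases "k \<in> R")
      case True
      then obtain j where "T $ k $ j \<noteq> 0"
        by (auto simp: R_def)
      \<comment> \<open>Here the nonzero entry of \<open>T\<close> is a right factor in
        \<open>M ** T = 0\<close> and \<open>N ** T = 0\<close> and kills columns; in the other case
        it is a left factor and kills rows.\<close>
      then have "M $ i $ k = 0" "N $ i $ k = 0" for i
        using nonneg_matrix_mult_eq_0[OF assms(2,1) annihilate(1)]
          nonneg_matrix_mult_eq_0[OF assms(3,1) annihilate(3)] by blast+
      then show ?thesis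
        by (simp add: column_def vec_eq_iff)
    next
      case False
      with that obtain i where "T $ i $ k \<noteq> 0"
        by (auto simp: Z_def C_def)
      then have "M $ k $ j = 0" "N $ k $ j = 0" for j
        using nonneg_matrix_mult_eq_0[OF assms(1,2) annihilate(2)]
          nonneg_matrix_mult_eq_0[OF assms(1,3) annihilate(4)] by blast+
      then show ?thesis
        by (simp add: row_def vec_eq_iff)
    qed
    then have "dim (range ((*v) T)) \<le> card Z"
      unfolding assms(4) by (rule dim_range_commutator_le[OF assms(2,5)])
    moreover have "dim ((*v) T ` E C) \<le> dim (range ((*v) T))"
      by (rule dim_subset) blast
    ultimately show ?thesis
      by (simp add: operator_rank_def E_def dim_image_axis)
  qed
  ultimately show ?thesis
    using annihilate std dsum by blast
qed

end
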